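(* Let $r>0$, let $P_0\in\mathcal{M}(\mathbb{R}^{N_x})$ be absolutely continuous with respect to the Lebesgue measure on $\mathbb{R}^{N_x}$, and let $\mathcal{P}:=\{P\in\mathcal{M}(\mathbb{R}^{N_x}) \mid W_2(P,P_0)\le r\}$. Let $C\in\mathbb{S}^{N_x}$ satisfy $\lambda_{\max}(C)\neq 0$, and let $M_0:=\mathbb{E}_{P_0}[ww^\top]$. Let $\gamma^\star\ge 0$ satisfy $\gamma^\star I\succ C$ and be a solution to the algebraic equation (in $\gamma$) $$\mathrm{Tr}\!\left(\left(\gamma(\gamma I-C)^{-1}-I\right)^2M_0\right)=r^2.$$ Let $P^\star\in\mathcal{M}(\mathbb{R}^{N_x})$ denote the distribution of $$w^\star:=\gamma^\star(\gamma^\star I-C)^{-1}w,\qquad\text{where } w\sim P_0.$$ Then $P^\star$ belongs to $\mathcal{P}$ and attains the optimal value of the worst-case expectation problem $\sup_{P\in\mathcal{P}}\mathbb{E}_P[w^\top C w]$, i.e. $\mathbb{E}_{P^\star}[w^\top C w]=\sup_{P\in\mathcal{P}}\mathbb{E}_P[w^\top C w]$.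
   Context: $N_x=n(T+1)$, where $n,T$ are positive integers. $\mathbb{S}^{N_x}$ is the set of real symmetric $N_x\times N_x$ matrices; $\lambda_{\max}(C)$ is the largest eigenvalue of $C$; $A\succ B$ means that $A-B$ is symmetric positive definite. $\mathcal{M}(\mathbb{R}^{N})$ denotes the collection of Borel probability measures on $\mathbb{R}^{N}$ with finite second moments. $\mathbb{E}_P$ denotes expectation when the random vector $w$ has distribution $P$. The type-2 Wasserstein distance between $P_1,P_2\in\mathcal{M}(\mathbb{R}^{N_x})$ is defined by $$W_2(P_1,P_2)^2:=\inf_{\pi\in\Pi(P_1,P_2)}\int_{\mathbb{R}^{N_x}\times\mathbb{R}^{N_x}}\|z_1-z_2\|^2\,\pi(dz_1,dz_2),$$ where $\|\cdot\|$ is the Euclidean norm and $\Pi(P_1,P_2)$ is the set of all joint distributions in $\mathcal{M}(\mathbb{R}^{N_x}\times\mathbb{R}^{N_x})$ with marginals $P_1$ and $P_2$. *)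

theory Defs
  imports "HOL-Probability.Probability"
begin

definition prob_measures2 :: "'a::euclidean_space measure set" where
  "prob_measures2 =
     {P. prob_space P \<and> sets P = sets borel \<and> integrable P (\<lambda>x. (norm x)\<^sup>2)}"

definition couplings ::
  "'a::euclidean_space measure \<Rightarrow> 'a measure \<Rightarrow> ('a \<times> 'a) measure set" where
  "couplings P1 P2 =
     {\<pi> \<in> prob_measures2. distr \<pi> borel fst = P1 \<and> distr \<pi> borel snd = P2}"

text \<open>
  For measures in \<open>prob_measures2\<close> the infimum ranges over a nonempty set (it contains the
  product coupling) of finite nonnegative integrals, so the real-valued infimum and Bochner
  integral are the intended ones.
\<close>

definition wasserstein2 :: "'a::euclidean_space measure \<Rightarrow> 'a measure \<Rightarrow> real" where
  "wasserstein2 P1 P2 =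
     sqrt (INF \<pi>\<in>couplings P1 P2. \<integral>z. (norm (fst z - snd z))\<^sup>2 \<partial>\<pi>)"

definition wasserstein_ball :: "real \<Rightarrow> 'a::euclidean_space measure \<Rightarrow> 'a measure set" where
  "wasserstein_ball r P0 = {P \<in> prob_measures2. wasserstein2 P P0 \<le> r}"

definition symmetric_matrix :: "real^'k^'k \<Rightarrow> bool" where
  "symmetric_matrix A \<longleftrightarrow> transpose A = A"

definition positive_definite :: "real^'k^'k \<Rightarrow> bool" where
  "positive_definite A \<longleftrightarrow> symmetric_matrix A \<and> (\<forall>x. x \<noteq> 0 \<longrightarrow> 0 < x \<bullet> (A *v x))"

definition matrix_greater :: "real^'k^'k \<Rightarrow> real^'k^'k \<Rightarrow> bool" (infix "\<succ>" 50) where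
  "A \<succ> B \<longleftrightarrow> positive_definite (A - B)"

text \<open>Only meaningful for symmetric matrices, whose set of real eigenvalues is finite and nonempty.\<close>

definition lambda_max :: "real^'k^'k \<Rightarrow> real" where
  "lambda_max A = Max {l. \<exists>v. v \<noteq> 0 \<and> A *v v = l *\<^sub>R v}"

definition second_moment_matrix :: "(real^'k) measure \<Rightarrow> real^'k^'k" where
  "second_moment_matrix P = (\<integral>w. (columnvector w :: real^1^'k) ** rowvector w \<partial>P)"

definition worst_case_map :: "real \<Rightarrow> real^'k^'k \<Rightarrow> real^'k^'k" where
  "worst_case_map \<gamma> C = \<gamma> *\<^sub>R matrix_inv (\<gamma> *\<^sub>R mat 1 - C)"

definition expected_quadratic_form :: "real^'k^'k \<Rightarrow> (real^'k) measure \<Rightarrow> real" where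
  "expected_quadratic_form C P = (\<integral>w. w \<bullet> (C *v w) \<partial>P)"

end

theory Submission
  imports Defs
begin

text \<open>
  Write \<open>G = \<gamma> I - C\<close>, which is positive definite, and \<open>A = \<gamma> G\<^sup>-\<^sup>1\<close> for the worst-case map.
  Completing the square in \<open>x\<close> gives, for all vectors \<open>x\<close> and \<open>w\<close>,
  \<open>x \<bullet> C x = \<gamma> \<parallel>x - w\<parallel>\<^sup>2 + \<gamma> (w \<bullet> A w - \<parallel>w\<parallel>\<^sup>2) - (x - A w) \<bullet> G (x - A w)\<close>.
  The last term is nonpositive and vanishes at \<open>x = A w\<close>. It is dropped and the rest integrated
  against a coupling of \<open>P\<close> with \<open>P0\<close>: with \<open>K\<close> the expectation of
  \<open>\<gamma> (w \<bullet> A w - \<parallel>w\<parallel>\<^sup>2)\<close> under \<open>P0\<close>, the expectation of \<open>x \<bullet> C x\<close> under \<open>P\<close> is at most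
  \<open>\<gamma>\<close> times the transport cost of the coupling, plus \<open>K\<close>. Taking the infimum over couplings
  bounds it by \<open>\<gamma> r\<^sup>2 + K\<close> for every \<open>P\<close> in the ball. This is weak duality, with \<open>\<gamma>\<close> the
  multiplier of the transport constraint.

  The bound is attained by moving \<open>w\<close> to \<open>A w\<close>: the square vanishes along the coupling
  \<open>(A w, w)\<close>, and its cost \<open>E \<parallel>A w - w\<parallel>\<^sup>2\<close> is, because \<open>A\<close> is symmetric, exactly the trace that
  the equation for \<open>\<gamma>\<close> sets equal to \<open>r\<^sup>2\<close>. The same computation shows that the pushforward of
  \<open>P0\<close> under \<open>A\<close> lies in the ball, since the cost of any coupling bounds the squared distance from
  above.
\<close>

section \<open>Measures with finite second moments\<close>

text \<open>
  By Cauchy-Schwarz the integrand grows at most like the square of the norm. The two maps are kept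
  general so that the lemma serves on the space itself and on its square, where the linear maps
  are projections, their difference, or their images under a matrix.
\<close>

lemma integrable_inner_linear:
  fixes L M :: "'a::euclidean_space \<Rightarrow> 'b::euclidean_space"
  assumes P: "P \<in> prob_measures2" and L: "linear L" and M: "linear M"
  shows "integrable P (\<lambda>x. L x \<bullet> M x)"
proof -
  have sets: "sets P = sets borel" and int: "integrable P (\<lambda>x. (norm x)\<^sup>2)"
    using P by (auto simp: prob_measures2_def)
  have bl: "bounded_linear L" "bounded_linear M"
    using L M by (simp_all add: linear_conv_bounded_linear)
  obtain a where a: "\<And>x. norm (L x) \<le> norm x * a" "a \<ge> 0"
    using bounded_linear.nonneg_bounded[OF bl(1)] by blast
  obtain b where b: "\<And>x. norm (M x) \<le> norm x * b" "b \<ge> 0"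
    using bounded_linear.nonneg_bounded[OF bl(2)] by blast
  have "continuous_on UNIV (\<lambda>x. L x \<bullet> M x)"
    using bl by (intro continuous_intros linear_continuous_on)
  then have meas: "(\<lambda>x. L x \<bullet> M x) \<in> borel_measurable P"
    using measurable_cong_sets[OF sets refl] borel_measurable_continuous_onI by blast
  have bound: "norm (L x \<bullet> M x) \<le> norm (a * b * (norm x)\<^sup>2)" for x
  proof -
    have "norm (L x \<bullet> M x) \<le> norm (L x) * norm (M x)"
      by (simp add: Cauchy_Schwarz_ineq2)
    also have "\<dots> \<le> (norm x * a) * (norm x * b)"
      using a b by (intro mult_mono) auto
    finally show ?thesis
      using a(2) b(2) by (simp add: power2_eq_square abs_mult mult_ac)
  qed
  show ?thesis
    by (rule Bochner_Integration.integrable_bound[OF integrable_mult_right[OF int] meas])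
      (use bound in blast)
qed

lemma borel_measurable_matrix_vector_mult [measurable]:
  "(\<lambda>w. A *v w :: real^'m) \<in> borel_measurable (borel :: (real^'k) measure)"
  by (intro borel_measurable_continuous_onI linear_continuous_on matrix_vector_mul_bounded_linear)

lemma distr_linear_in_prob_measures2:
  fixes L :: "'a::euclidean_space \<Rightarrow> 'b::euclidean_space"
  assumes P: "P \<in> prob_measures2" and L: "linear L"
  shows "distr P borel L \<in> prob_measures2"
proof -
  interpret prob_space P using P by (simp add: prob_measures2_def)
  have sets: "sets P = sets borel" using P by (simp add: prob_measures2_def)
  have meas: "L \<in> borel_measurable P"
    using L measurable_cong_sets[OF sets refl]
    by (metis borel_measurable_continuous_onI linear_continuous_on linear_conv_bounded_linear)
  have "integrable P (\<lambda>x. (norm (L x))\<^sup>2)"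
    using integrable_inner_linear[OF P L L] by (simp add: power2_norm_eq_inner)
  then have "integrable (distr P borel L) (\<lambda>x. (norm x)\<^sup>2)"
    by (subst integrable_distr_eq[OF meas]) auto
  then show ?thesis
    using prob_space_distr[OF meas] by (simp add: prob_measures2_def)
qed

section \<open>Couplings\<close>

lemma distr_pair_snd:
  assumes "prob_space M" and "prob_space N"
  shows "distr (M \<Otimes>\<^sub>M N) N snd = N"
proof -
  interpret M: prob_space M by fact
  interpret N: prob_space N by fact
  interpret pair_sigma_finite M N ..
  have "distr (M \<Otimes>\<^sub>M N) N snd = distr (distr (N \<Otimes>\<^sub>M M) (M \<Otimes>\<^sub>M N) (\<lambda>(x, y). (y, x))) N snd"
    using distr_pair_swap by simp
  also have "\<dots> = distr (N \<Otimes>\<^sub>M M) N fst"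
    by (subst distr_distr) (auto intro!: distr_cong simp: comp_def case_prod_beta)
  finally show ?thesis
    by (simp add: M.distr_pair_fst)
qed

text \<open>
  The real infimum defining \<open>wasserstein2\<close> carries information only over a nonempty set of
  couplings; independence provides one.
\<close>

lemma product_in_couplings:
  assumes P: "P \<in> prob_measures2" and Q: "Q \<in> prob_measures2"
  shows "P \<Otimes>\<^sub>M Q \<in> couplings P Q"
proof -
  interpret P: prob_space P using P by (simp add: prob_measures2_def)
  interpret Q: prob_space Q using Q by (simp add: prob_measures2_def)
  interpret PQ: pair_prob_space P Q ..
  have sP: "sets P = sets borel" and sQ: "sets Q = sets borel"
    and iP: "integrable P (\<lambda>x. (norm x)\<^sup>2)" and iQ: "integrable Q (\<lambda>x. (norm x)\<^sup>2)"
    using P Q by (auto simp: prob_measures2_def)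
  have sets: "sets (P \<Otimes>\<^sub>M Q) = sets borel"
    using sets_pair_measure_cong[OF sP sQ] by (simp only: borel_prod)
  have fst: "distr (P \<Otimes>\<^sub>M Q) P fst = P" by (rule Q.distr_pair_fst)
  have snd: "distr (P \<Otimes>\<^sub>M Q) Q snd = Q"
    by (rule distr_pair_snd) unfold_locales
  have "integrable (P \<Otimes>\<^sub>M Q) (\<lambda>z. (norm (fst z))\<^sup>2)"
    by (rule integrable_distr[OF measurable_fst]) (simp add: fst iP)
  moreover have "integrable (P \<Otimes>\<^sub>M Q) (\<lambda>z. (norm (snd z))\<^sup>2)"
    by (rule integrable_distr[OF measurable_snd]) (simp add: snd iQ)
  moreover have "(norm z)\<^sup>2 = (norm (fst z))\<^sup>2 + (norm (snd z))\<^sup>2" for z :: "'a \<times> 'a"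
    by (simp add: norm_prod_def)
  ultimately have "integrable (P \<Otimes>\<^sub>M Q) (\<lambda>z. (norm z)\<^sup>2)"
    by simp
  moreover have "distr (P \<Otimes>\<^sub>M Q) borel fst = P" "distr (P \<Otimes>\<^sub>M Q) borel snd = Q"
    using fst snd distr_cong[OF refl sP] distr_cong[OF refl sQ] by metis+
  ultimately show ?thesis
    using sets PQ.P.prob_space_axioms by (simp add: couplings_def prob_measures2_def)
qed

lemma integral_coupling:
  fixes f :: "'a::euclidean_space \<Rightarrow> real"
  assumes "\<pi> \<in> couplings P Q" and f: "f \<in> borel_measurable borel"
  shows "(\<integral>x. f x \<partial>P) = (\<integral>z. f (fst z) \<partial>\<pi>)" and "(\<integral>x. f x \<partial>Q) = (\<integral>z. f (snd z) \<partial>\<pi>)"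
proof -
  have sets: "sets \<pi> = sets borel"
    and P: "P = distr \<pi> borel fst" and Q: "Q = distr \<pi> borel snd"
    using assms(1) by (auto simp: couplings_def prob_measures2_def)
  have m: "fst \<in> measurable \<pi> borel" "snd \<in> measurable \<pi> borel"
    unfolding measurable_cong_sets[OF sets refl]
    by (auto intro!: borel_measurable_continuous_onI continuous_intros)
  show "(\<integral>x. f x \<partial>P) = (\<integral>z. f (fst z) \<partial>\<pi>)"
    unfolding P by (rule integral_distr[OF m(1) f])
  show "(\<integral>x. f x \<partial>Q) = (\<integral>z. f (snd z) \<partial>\<pi>)"
    unfolding Q by (rule integral_distr[OF m(2) f])
qed

text \<open>
  A deterministic transport plan: its explicit cost bounds the distance from \<open>P\<close> to its image,
  which is how the worst-case measure is placed in the ball.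
\<close>

lemma graph_coupling:
  fixes L :: "'a::euclidean_space \<Rightarrow> 'a"
  assumes P: "P \<in> prob_measures2" and L: "linear L"
  shows "distr P borel (\<lambda>w. (L w, w)) \<in> couplings (distr P borel L) P"
    and "(\<integral>z. (norm (fst z - snd z))\<^sup>2 \<partial>distr P borel (\<lambda>w. (L w, w))) =
      (\<integral>w. (norm (L w - w))\<^sup>2 \<partial>P)"
proof -
  have sets: "sets P = sets borel" using P by (simp add: prob_measures2_def)
  have lin: "linear (\<lambda>w. (L w, w))"
    using L by (auto simp: linear_iff)
  have meas: "(\<lambda>w. (L w, w)) \<in> measurable P borel"
    using lin measurable_cong_sets[OF sets refl]
    by (metis borel_measurable_continuous_onI linear_continuous_on linear_conv_bounded_linear)
  have m: "fst \<in> borel_measurable (borel :: ('a \<times> 'a) measure)"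
    "snd \<in> borel_measurable (borel :: ('a \<times> 'a) measure)"
    by (auto intro!: borel_measurable_continuous_onI continuous_intros)
  have "distr (distr P borel (\<lambda>w. (L w, w))) borel fst = distr P borel L"
    by (subst distr_distr[OF m(1) meas]) (simp add: comp_def)
  moreover have "distr (distr P borel (\<lambda>w. (L w, w))) borel snd = P"
    by (subst distr_distr[OF m(2) meas]) (simp add: comp_def distr_id2[OF sets[symmetric]])
  ultimately show "distr P borel (\<lambda>w. (L w, w)) \<in> couplings (distr P borel L) P"
    using distr_linear_in_prob_measures2[OF P lin] by (simp add: couplings_def)
  show "(\<integral>z. (norm (fst z - snd z))\<^sup>2 \<partial>distr P borel (\<lambda>w. (L w, w))) =
      (\<integral>w. (norm (L w - w))\<^sup>2 \<partial>P)"
    by (subst integral_distr[OF meas])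
      (auto intro!: borel_measurable_continuous_onI continuous_intros)
qed

lemma wasserstein2_le_coupling:
  assumes "\<pi> \<in> couplings P Q"
  shows "wasserstein2 P Q \<le> sqrt (\<integral>z. (norm (fst z - snd z))\<^sup>2 \<partial>\<pi>)"
  unfolding wasserstein2_def using assms
  by (intro real_sqrt_le_mono cINF_lower bdd_belowI[of _ 0]) auto

section \<open>Second moments and traces\<close>

lemma dot_symmetric_matrix:
  fixes A :: "real^'k^'k"
  assumes "symmetric_matrix A"
  shows "(A *v x) \<bullet> y = x \<bullet> (A *v y)"
  using assms dot_lmul_matrix[of x A y] transpose_matrix_vector[of A x]
  by (simp add: symmetric_matrix_def)

lemma trace_mult_outer_product:
  fixes X :: "real^'k^'k"
  shows "trace (X ** ((columnvector w :: real^1^'k) ** rowvector w)) = w \<bullet> (X *v w)"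
  by (simp add: trace_def matrix_matrix_mult_def columnvector_def rowvector_def inner_vec_def
      matrix_vector_mult_def sum_distrib_left mult_ac)

lemma integrable_outer_product:
  fixes P :: "(real^'k) measure"
  assumes P: "P \<in> prob_measures2"
  shows "integrable P (\<lambda>w. (columnvector w :: real^1^'k) ** rowvector w)"
proof -
  have sets: "sets P = sets borel" and int: "integrable P (\<lambda>x. (norm x)\<^sup>2)"
    using P by (auto simp: prob_measures2_def)
  have entry: "((columnvector w :: real^1^'k) ** rowvector w) = (\<chi> i j. w $ i * w $ j)"
    for w :: "real^'k"
    by (simp add: vec_eq_iff matrix_matrix_mult_def columnvector_def rowvector_def)
  have "continuous_on UNIV (\<lambda>w::real^'k. (\<chi> i j. w $ i * w $ j))"
    by (intro continuous_intros)
  then have meas: "(\<lambda>w. (\<chi> i j. w $ i * w $ j)) \<in> borel_measurable P"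
    using measurable_cong_sets[OF sets refl] borel_measurable_continuous_onI by blast
  \<comment> \<open>The norm on matrices is the Frobenius norm, so the outer product of \<open>w\<close> with itself has norm
    \<open>\<parallel>w\<parallel>\<^sup>2\<close>.\<close>
  have "(norm (\<chi> i j. w $ i * w $ j))\<^sup>2 = ((norm w)\<^sup>2)\<^sup>2" for w :: "real^'k"
    by (simp add: power2_norm_eq_inner inner_vec_def power2_eq_square[of "sum _ _"] sum_product
        mult_ac)
  then have norm: "norm (\<chi> i j. w $ i * w $ j) = (norm w)\<^sup>2" for w :: "real^'k"
    by (metis norm_ge_zero power2_eq_imp_eq zero_le_power2)
  show ?thesis
    unfolding entry
    by (rule Bochner_Integration.integrable_bound[OF int meas]) (simp add: norm)
qed

text \<open>
  The trace is a linear function of the matrix, so it can be taken under the integral.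
\<close>

lemma trace_second_moment_matrix:
  fixes X :: "real^'k^'k"
  assumes P: "P \<in> prob_measures2"
  shows "trace (X ** second_moment_matrix P) = (\<integral>w. w \<bullet> (X *v w) \<partial>P)"
proof -
  have "linear (\<lambda>M :: real^'k^'k. trace (X ** M))"
    by (rule linearI)
      (simp_all add: matrix_add_ldistrib trace_add trace_def matrix_matrix_mult_def
        sum_distrib_left mult_ac sum.distrib algebra_simps)
  then have "bounded_linear (\<lambda>M :: real^'k^'k. trace (X ** M))"
    by (simp add: linear_conv_bounded_linear)
  from integral_bounded_linear[OF this integrable_outer_product[OF P]]
  show ?thesis
    by (simp add: second_moment_matrix_def trace_mult_outer_product)
qed

section \<open>Completing the square\<close>

lemma matrix_inv_positive_definite:
  fixes G :: "real^'k^'k"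
  assumes "positive_definite G"
  shows "G ** matrix_inv G = mat 1"
proof -
  have "x = 0" if "G *v x = 0" for x
    using assms that by (force simp: positive_definite_def)
  then have "invertible G"
    by (simp add: invertible_left_inverse matrix_left_invertible_ker)
  then show ?thesis
    unfolding invertible_def matrix_inv_def by (rule someI2_ex) blast
qed

lemma worst_case_map_solves:
  fixes C :: "real^'k^'k"
  assumes "\<gamma> *\<^sub>R mat 1 \<succ> C"
  shows "(\<gamma> *\<^sub>R mat 1 - C) *v (worst_case_map \<gamma> C *v w) = \<gamma> *\<^sub>R w"
proof -
  define G where "G = \<gamma> *\<^sub>R mat 1 - C"
  have "G ** matrix_inv G = mat 1"
    using assms by (intro matrix_inv_positive_definite) (simp add: matrix_greater_def G_def)
  then have "G *v (matrix_inv G *v w) = w"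
    by (simp add: matrix_vector_mul_assoc)
  then show ?thesis
    by (simp add: worst_case_map_def G_def[symmetric] scaleR_matrix_vector_assoc[symmetric]
        matrix_vector_mult_scaleR)
qed

lemma symmetric_matrix_iff_dot:
  fixes A :: "real^'k^'k"
  shows "symmetric_matrix A \<longleftrightarrow> (\<forall>x y. (A *v x) \<bullet> y = x \<bullet> (A *v y))"
proof
  assume "\<forall>x y. (A *v x) \<bullet> y = x \<bullet> (A *v y)"
  then have "x \<bullet> (transpose A *v y - A *v y) = 0" for x y
    using dot_lmul_matrix[of y A x] transpose_matrix_vector[of A y]
    by (simp add: inner_diff_right inner_commute)
  then have "transpose A *v y = A *v y" for y
    by (metis inner_eq_zero_iff right_minus_eq)
  then show "symmetric_matrix A"
    by (simp add: symmetric_matrix_def matrix_eq)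
qed (simp add: dot_symmetric_matrix)

lemma symmetric_worst_case_map:
  fixes C :: "real^'k^'k"
  assumes "\<gamma> *\<^sub>R mat 1 \<succ> C"
  shows "symmetric_matrix (worst_case_map \<gamma> C)"
proof -
  define G A where "G = \<gamma> *\<^sub>R mat 1 - C" and "A = worst_case_map \<gamma> C"
  have symG: "symmetric_matrix G"
    using assms by (simp add: matrix_greater_def positive_definite_def G_def)
  have GA: "G *v (A *v w) = \<gamma> *\<^sub>R w" for w
    unfolding G_def A_def by (rule worst_case_map_solves[OF assms])
  \<comment> \<open>Symmetry passes from \<open>G\<close> to \<open>A\<close> through \<open>G A = \<gamma> I\<close>, after cancelling \<open>\<gamma>\<close>.\<close>
  show ?thesis
  proof (cases "\<gamma> = 0")
    case True
    then show ?thesis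
      by (simp add: symmetric_matrix_def worst_case_map_def transpose_def vec_eq_iff)
  next
    case False
    have "\<gamma> * ((A *v x) \<bullet> y) = \<gamma> * (x \<bullet> (A *v y))" for x y
      using dot_symmetric_matrix[OF symG, of "A *v x" "A *v y"] by (auto simp: GA)
    then show ?thesis
      using False unfolding symmetric_matrix_iff_dot A_def[symmetric] by simp
  qed
qed

text \<open>
  Since \<open>C = \<gamma> I - G\<close> and \<open>G A w = \<gamma> w\<close>, the point \<open>A w\<close> is the critical point of
  \<open>x \<bullet> C x - \<gamma> \<parallel>x - w\<parallel>\<^sup>2\<close>, a quadratic function of \<open>x\<close> with leading part \<open>- x \<bullet> G x\<close>; its
  maximal value is the second summand.
\<close>

lemma completed_square:
  fixes C :: "real^'k^'k"
  assumes "\<gamma> *\<^sub>R mat 1 \<succ> C"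
  defines "A \<equiv> worst_case_map \<gamma> C" and "G \<equiv> \<gamma> *\<^sub>R mat 1 - C"
  shows "x \<bullet> (C *v x) = \<gamma> * (norm (x - w))\<^sup>2 + \<gamma> * (w \<bullet> (A *v w) - (norm w)\<^sup>2)
    - (x - A *v w) \<bullet> (G *v (x - A *v w))"
proof -
  have symG: "symmetric_matrix G"
    using assms by (simp add: matrix_greater_def positive_definite_def G_def)
  have GA: "G *v (A *v w) = \<gamma> *\<^sub>R w"
    unfolding G_def A_def by (rule worst_case_map_solves[OF assms(1)])
  have Cx: "C *v x = \<gamma> *\<^sub>R x - G *v x"
    by (simp add: G_def matrix_vector_mult_diff_rdistrib scaleR_matrix_vector_assoc[symmetric])
  have cross: "(A *v w) \<bullet> (G *v x) = \<gamma> * (w \<bullet> x)"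
    using dot_symmetric_matrix[OF symG, of "A *v w" x] by (simp add: GA)
  show ?thesis
    unfolding Cx
    by (simp add: power2_norm_eq_inner matrix_vector_mult_diff_distrib inner_diff_left
        inner_diff_right GA cross inner_commute algebra_simps)
qed

section \<open>Weak duality and attainment\<close>

text \<open>
  \<open>\<gamma>\<close> acts as a Lagrange multiplier for the transport constraint: dropping the square leaves a
  bound that sees \<open>P\<close> only through its distance to \<open>P0\<close>.
\<close>

lemma expected_quadratic_form_le:
  fixes C :: "real^'k^'k" and P P0 :: "(real^'k) measure"
  assumes P: "P \<in> wasserstein_ball r P0" and P0: "P0 \<in> prob_measures2"
    and "0 < r" and "0 \<le> \<gamma>" and C: "\<gamma> *\<^sub>R mat 1 \<succ> C"
  shows "expected_quadratic_form C P \<le>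
    \<gamma> * r\<^sup>2 + (\<integral>w. \<gamma> * (w \<bullet> (worst_case_map \<gamma> C *v w) - (norm w)\<^sup>2) \<partial>P0)"
proof -
  define A where "A = worst_case_map \<gamma> C"
  define k where "k = (\<lambda>w. \<gamma> * (w \<bullet> (A *v w) - (norm w)\<^sup>2))"
  define cost where "cost = (\<lambda>\<pi>. \<integral>z. (norm (fst z - snd z :: real^'k))\<^sup>2 \<partial>\<pi>)"
  have PM: "P \<in> prob_measures2" and W: "wasserstein2 P P0 \<le> r"
    using P by (auto simp: wasserstein_ball_def)
  have kmeas: "k \<in> borel_measurable borel"
    and qmeas: "(\<lambda>x. x \<bullet> (C *v x)) \<in> borel_measurable borel"
    unfolding k_def by measurable
  have le: "x \<bullet> (C *v x) \<le> \<gamma> * (norm (x - w))\<^sup>2 + k w" for x w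
  proof -
    have "0 \<le> y \<bullet> ((\<gamma> *\<^sub>R mat 1 - C) *v y)" for y
      using C by (cases "y = 0") (auto simp: matrix_greater_def positive_definite_def less_imp_le)
    then show ?thesis
      using completed_square[OF C, of x w] by (simp add: k_def A_def)
  qed
  have dual: "expected_quadratic_form C P \<le> \<gamma> * cost \<pi> + (\<integral>w. k w \<partial>P0)"
    if \<pi>: "\<pi> \<in> couplings P P0" for \<pi>
  proof -
    have \<pi>M: "\<pi> \<in> prob_measures2" using \<pi> by (simp add: couplings_def)
    note lin = linear_fst linear_snd linear_compose[OF linear_fst, unfolded comp_def]
      linear_compose[OF linear_snd, unfolded comp_def] linear_compose_sub
    have i1: "integrable \<pi> (\<lambda>z. fst z \<bullet> (C *v fst z))"
      and i2: "integrable \<pi> (\<lambda>z. (norm (fst z - snd z))\<^sup>2)"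
      and i3: "integrable \<pi> (\<lambda>z. k (snd z))"
      unfolding k_def power2_norm_eq_inner
      by (auto intro!: integrable_inner_linear[OF \<pi>M] Bochner_Integration.integrable_diff
          integrable_mult_right lin matrix_vector_mul_linear)
    have "expected_quadratic_form C P = (\<integral>z. fst z \<bullet> (C *v fst z) \<partial>\<pi>)"
      unfolding expected_quadratic_form_def by (rule integral_coupling[OF \<pi> qmeas])
    also have "\<dots> \<le> (\<integral>z. \<gamma> * (norm (fst z - snd z))\<^sup>2 + k (snd z) \<partial>\<pi>)"
      using i1 i2 i3 le by (intro integral_mono) auto
    also have "\<dots> = \<gamma> * cost \<pi> + (\<integral>w. k w \<partial>P0)"
      using i2 i3 by (simp add: cost_def integral_coupling(2)[OF \<pi> kmeas])
    finally show ?thesis .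
  qed
  have ne: "couplings P P0 \<noteq> {}"
    using product_in_couplings[OF PM P0] by blast
  have "sqrt (INF \<pi>\<in>couplings P P0. cost \<pi>) \<le> sqrt (r\<^sup>2)"
    using W \<open>0 < r\<close> by (simp add: wasserstein2_def cost_def)
  then have inf: "(INF \<pi>\<in>couplings P P0. cost \<pi>) \<le> r\<^sup>2"
    by (simp only: real_sqrt_le_iff)
  have "expected_quadratic_form C P \<le> \<gamma> * r\<^sup>2 + (\<integral>w. k w \<partial>P0)"
  proof (cases "\<gamma> = 0")
    \<comment> \<open>Without a transport term, the bound from any single coupling suffices.\<close>
    case True
    then show ?thesis using ne dual by fastforce
  next
    case False
    then have "(expected_quadratic_form C P - (\<integral>w. k w \<partial>P0)) / \<gamma> \<le> cost \<pi>"
      if "\<pi> \<in> couplings P P0" for \<pi>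
      using dual[OF that] \<open>0 \<le> \<gamma>\<close> by (simp add: field_simps)
    then have "(expected_quadratic_form C P - (\<integral>w. k w \<partial>P0)) / \<gamma> \<le> r\<^sup>2"
      using cINF_greatest[OF ne] inf by (meson order_trans)
    then show ?thesis
      using False \<open>0 \<le> \<gamma>\<close> by (simp add: field_simps)
  qed
  then show ?thesis by (simp add: k_def A_def)
qed

text \<open>
  The left side of the equation for \<open>\<gamma>\<close> is a transport cost: for symmetric \<open>B\<close>, the quadratic form
  of \<open>B\<^sup>2\<close> at \<open>w\<close> is \<open>\<parallel>B w\<parallel>\<^sup>2\<close>.
\<close>

lemma integral_transport_cost_worst_case_map:
  fixes C :: "real^'k^'k"
  assumes P: "P \<in> prob_measures2" and C: "\<gamma> *\<^sub>R mat 1 \<succ> C"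
  defines "B \<equiv> worst_case_map \<gamma> C - mat 1"
  shows "(\<integral>w. (norm (worst_case_map \<gamma> C *v w - w))\<^sup>2 \<partial>P) =
    trace (B ** B ** second_moment_matrix P)"
proof -
  have "symmetric_matrix B"
    using symmetric_worst_case_map[OF C]
    by (simp add: B_def symmetric_matrix_iff_dot matrix_vector_mult_diff_rdistrib
        inner_diff_left inner_diff_right)
  then have "w \<bullet> (B ** B *v w) = (norm (B *v w))\<^sup>2" for w
    by (simp add: power2_norm_eq_inner matrix_vector_mul_assoc[symmetric] dot_symmetric_matrix)
  then show ?thesis
    by (simp add: trace_second_moment_matrix[OF P]) (simp add: B_def matrix_vector_mult_diff_rdistrib)
qed

text \<open>
  At \<open>x = A w\<close> the square vanishes, so the dual bound becomes an equality.
\<close>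

lemma expected_quadratic_form_worst_case:
  fixes C :: "real^'k^'k" and P0 :: "(real^'k) measure"
  assumes P0: "P0 \<in> prob_measures2" and C: "\<gamma> *\<^sub>R mat 1 \<succ> C"
  defines "A \<equiv> worst_case_map \<gamma> C"
  shows "expected_quadratic_form C (distr P0 borel (\<lambda>w. A *v w)) =
    \<gamma> * (\<integral>w. (norm (A *v w - w))\<^sup>2 \<partial>P0) + (\<integral>w. \<gamma> * (w \<bullet> (A *v w) - (norm w)\<^sup>2) \<partial>P0)"
proof -
  have sets: "sets P0 = sets borel" using P0 by (simp add: prob_measures2_def)
  have meas: "(\<lambda>w. A *v w) \<in> measurable P0 borel"
    unfolding measurable_cong_sets[OF sets refl] by measurable
  have "expected_quadratic_form C (distr P0 borel (\<lambda>w. A *v w)) =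
      (\<integral>w. (A *v w) \<bullet> (C *v (A *v w)) \<partial>P0)"
    unfolding expected_quadratic_form_def
    by (rule integral_distr[OF meas]) measurable
  also have "\<dots> = (\<integral>w. \<gamma> * (norm (A *v w - w))\<^sup>2 + \<gamma> * (w \<bullet> (A *v w) - (norm w)\<^sup>2) \<partial>P0)"
    using completed_square[OF C, of "A *v w" w for w] by (simp add: A_def)
  also have "\<dots> = \<gamma> * (\<integral>w. (norm (A *v w - w))\<^sup>2 \<partial>P0)
      + (\<integral>w. \<gamma> * (w \<bullet> (A *v w) - (norm w)\<^sup>2) \<partial>P0)"
  proof -
    have "integrable P0 (\<lambda>w. (norm (A *v w - w))\<^sup>2)"
      and "integrable P0 (\<lambda>w. \<gamma> * (w \<bullet> (A *v w) - (norm w)\<^sup>2))"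
      unfolding power2_norm_eq_inner
      by (auto intro!: integrable_inner_linear[OF P0] Bochner_Integration.integrable_diff
          integrable_mult_right linear_compose_sub matrix_vector_mul_linear linear_ident)
    then show ?thesis by simp
  qed
  finally show ?thesis .
qed

theorem theorem3:
  fixes n T :: nat
    and r \<gamma> :: real
    and P0 Pstar :: "(real^'k) measure"
    and C M0 :: "real^'k^'k"
  assumes "0 < n" and "0 < T" and "CARD('k) = n * (T + 1)"
    and "0 < r"
    and "P0 \<in> prob_measures2"
    and "absolutely_continuous lborel P0"
    and "symmetric_matrix C"
    and "lambda_max C \<noteq> 0"
    and "M0 = second_moment_matrix P0"
    and "0 \<le> \<gamma>"
    and "\<gamma> *\<^sub>R mat 1 \<succ> C"
    and "trace ((worst_case_map \<gamma> C - mat 1) ** (worst_case_map \<gamma> C - mat 1) ** M0) = r\<^sup>2"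
    and "Pstar = distr P0 borel (\<lambda>w. worst_case_map \<gamma> C *v w)"
  shows "Pstar \<in> wasserstein_ball r P0 \<and>
    ereal (expected_quadratic_form C Pstar) =
      (SUP P\<in>wasserstein_ball r P0. ereal (expected_quadratic_form C P))"
proof -
  note P0 = \<open>P0 \<in> prob_measures2\<close> and C = \<open>\<gamma> *\<^sub>R mat 1 \<succ> C\<close>
  define A where "A = worst_case_map \<gamma> C"
  have lin: "linear (\<lambda>w. A *v w)" by (rule matrix_vector_mul_linear)
  have Pstar: "Pstar = distr P0 borel (\<lambda>w. A *v w)"
    using assms by (simp add: A_def)
  have cost: "(\<integral>w. (norm (A *v w - w))\<^sup>2 \<partial>P0) = r\<^sup>2"
    using integral_transport_cost_worst_case_map[OF P0 C] assms by (simp add: A_def)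
  have "wasserstein2 Pstar P0 \<le> sqrt (r\<^sup>2)"
    using wasserstein2_le_coupling[OF graph_coupling(1)[OF P0 lin]]
    by (simp only: graph_coupling(2)[OF P0 lin] cost Pstar)
  then have ball: "Pstar \<in> wasserstein_ball r P0"
    using distr_linear_in_prob_measures2[OF P0 lin] \<open>0 < r\<close>
    by (simp add: wasserstein_ball_def Pstar)
  have "expected_quadratic_form C P \<le> expected_quadratic_form C Pstar"
    if "P \<in> wasserstein_ball r P0" for P
    using expected_quadratic_form_le[OF that P0 \<open>0 < r\<close> \<open>0 \<le> \<gamma>\<close> C]
      expected_quadratic_form_worst_case[OF P0 C] cost
    by (simp add: Pstar A_def)
  then have "ereal (expected_quadratic_form C Pstar) =
      (SUP P\<in>wasserstein_ball r P0. ereal (expected_quadratic_form C P))"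
    using ball by (intro antisym SUP_upper SUP_least) auto
  with ball show ?thesis by blast
qed

end
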